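(* Let $V$ be an $n$-dimensional real vector space, let $t>0$ be an integer, and let $W$ be a $t$-self-annihilating subspace of $\bigwedge^a V$. Then $\dim W\le AK(n,a,t)$.
   Context: $\bigwedge V^*$ is identified with the dual of $\bigwedge V$: different degrees pair to zero, and $\langle v_1\wedge\dots\wedge v_k,\,w_1^*\wedge\dots\wedge w_k^*\rangle=\det(w_j^*(v_i))$. The interior product $\llcorner:\bigwedge V\times\bigwedge V^*\to\bigwedge V$ is the bilinear map defined by $\langle v\llcorner w^*,u^*\rangle=\langle v,w^*\wedge u^*\rangle$ for all $v\in\bigwedge V$, $w^*,u^*\in\bigwedge V^*$. An element of $\bigwedge^r V^*$ is decomposable if it has the form $y_1^*\wedge\dots\wedge y_r^*$ with $y_i^*\in V^*$ (scalars, of degree $0$, count as decomposable). A subspace $W\subseteq\bigwedge V$ is $t$-self-annihilating if $(u\llcorner y^* )\wedge(w\llcorner y^* )=0$ for all $u,w\in W$ and every decomposable $y^*\in\bigwedge^r V^*$ with $0\le r<t$. $[n]=\{1,\dots,n\}$. A family $\mathcal A$ of subsets of $[n]$ is $t$-intersecting if $|A\cap B|\ge t$ for all $A,B\in\mathcal A$ (including $A=B$), and $a$-uniform if all its members have exactly $a$ elements. $AK(n,a,t)$ denotes the maximum size of an $a$-uniform $t$-intersecting family of subsets of $[n]$. *)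

theory Defs
  imports Complex_Main "HOL-Library.Poly_Mapping" "Jordan_Normal_Form.Determinant"
begin

section \<open>The dual space\<close>

typedef (overloaded) ('v::real_vector) dual = "{f :: 'v \<Rightarrow> real. linear f}"
  morphisms dual_apply Abs_dual
  by (rule exI[of _ "\<lambda>_. 0"]) (simp add: linear_iff)

setup_lifting type_definition_dual

instantiation dual :: (real_vector) real_vector
begin

lift_definition zero_dual :: "'a dual" is "\<lambda>_. 0"
  by (simp add: linear_iff)
lift_definition plus_dual :: "'a dual \<Rightarrow> 'a dual \<Rightarrow> 'a dual" is "\<lambda>f g x. f x + g x"
  by (simp add: linear_iff algebra_simps)
lift_definition minus_dual :: "'a dual \<Rightarrow> 'a dual \<Rightarrow> 'a dual" is "\<lambda>f g x. f x - g x"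
  by (simp add: linear_iff algebra_simps)
lift_definition uminus_dual :: "'a dual \<Rightarrow> 'a dual" is "\<lambda>f x. - f x"
  by (simp add: linear_iff algebra_simps)
lift_definition scaleR_dual :: "real \<Rightarrow> 'a dual \<Rightarrow> 'a dual" is "\<lambda>c f x. c * f x"
  by (simp add: linear_iff algebra_simps)

instance
  by standard (transfer; simp add: fun_eq_iff algebra_simps)+

end

lemma linear_dual_apply: "linear (dual_apply f)"
  using dual_apply by auto

lemma dual_apply_add_left: "dual_apply (f + g) x = dual_apply f x + dual_apply g x"
  by transfer simp

lemma dual_apply_scaleR_left: "dual_apply (c *\<^sub>R f) x = c * dual_apply f x"
  by transfer simp


section \<open>The free associative algebra on a set of letters\<close>

datatype 'v fmon = FMon (letters: "'v list")

instantiation fmon :: (type) monoid_add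
begin

definition zero_fmon :: "'a fmon" where "zero_fmon = FMon []"
definition plus_fmon :: "'a fmon \<Rightarrow> 'a fmon \<Rightarrow> 'a fmon"
  where "plus_fmon x y = FMon (letters x @ letters y)"

instance
  by standard (simp_all add: zero_fmon_def plus_fmon_def)

end

type_synonym 'v free_alg = "'v fmon \<Rightarrow>\<^sub>0 real"

definition fword :: "'v list \<Rightarrow> 'v free_alg"
  where "fword xs = Poly_Mapping.single (FMon xs) 1"

inductive_set two_sided_ideal :: "'a::ring_1 set \<Rightarrow> 'a set" for G where
  gen: "g \<in> G \<Longrightarrow> g \<in> two_sided_ideal G"
| zero: "0 \<in> two_sided_ideal G"
| add: "x \<in> two_sided_ideal G \<Longrightarrow> y \<in> two_sided_ideal G \<Longrightarrow> x + y \<in> two_sided_ideal G"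
| mult_left: "x \<in> two_sided_ideal G \<Longrightarrow> r * x \<in> two_sided_ideal G"
| mult_right: "x \<in> two_sided_ideal G \<Longrightarrow> x * r \<in> two_sided_ideal G"

lemma two_sided_ideal_uminus:
  assumes "x \<in> two_sided_ideal G" shows "- x \<in> two_sided_ideal G"
  using two_sided_ideal.mult_left[OF assms, of "- 1"] by simp

lemma two_sided_ideal_minus:
  assumes "x \<in> two_sided_ideal G" "y \<in> two_sided_ideal G"
  shows "x - y \<in> two_sided_ideal G"
  using two_sided_ideal.add[OF assms(1) two_sided_ideal_uminus[OF assms(2)]] by simp


section \<open>The exterior algebra\<close>

text \<open>
  The first two families of relators turn the free algebra on the set of vectors into
  the tensor algebra of the vector space; the third one kills the squares of vectors.
\<close>

definition ext_relators :: "'v::real_vector free_alg set" where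
  "ext_relators =
     {fword [v + w] - fword [v] - fword [w] | v w. True} \<union>
     {fword [c *\<^sub>R v] - Poly_Mapping.single 0 c * fword [v] | c v. True} \<union>
     {fword [v, v] | v. True}"

definition ext_rel :: "'v::real_vector free_alg \<Rightarrow> 'v free_alg \<Rightarrow> bool"
  where "ext_rel p q \<longleftrightarrow> p - q \<in> two_sided_ideal ext_relators"

lemma ext_rel_add:
  assumes "ext_rel p p'" "ext_rel q q'" shows "ext_rel (p + q) (p' + q')"
  using two_sided_ideal.add[OF assms[unfolded ext_rel_def]]
  by (simp add: ext_rel_def algebra_simps)

lemma ext_rel_minus:
  assumes "ext_rel p p'" "ext_rel q q'" shows "ext_rel (p - q) (p' - q')"
  using two_sided_ideal_minus[OF assms[unfolded ext_rel_def]]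
  by (simp add: ext_rel_def algebra_simps)

lemma ext_rel_uminus:
  assumes "ext_rel p p'" shows "ext_rel (- p) (- p')"
  using two_sided_ideal_uminus[OF assms[unfolded ext_rel_def]]
  by (simp add: ext_rel_def algebra_simps)

lemma ext_rel_mult:
  assumes "ext_rel p p'" "ext_rel q q'" shows "ext_rel (p * q) (p' * q')"
  using two_sided_ideal.add[OF two_sided_ideal.mult_right[OF assms(1)[unfolded ext_rel_def], of q]
      two_sided_ideal.mult_left[OF assms(2)[unfolded ext_rel_def], of p']]
  by (simp add: ext_rel_def algebra_simps)

lemma ext_rel_refl: "ext_rel p p"
  by (simp add: ext_rel_def two_sided_ideal.zero)

lemma equivp_ext_rel: "equivp (ext_rel :: 'v::real_vector free_alg \<Rightarrow> _)"
proof (rule equivpI)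
  show "reflp (ext_rel :: 'v free_alg \<Rightarrow> _)" by (rule reflpI) (rule ext_rel_refl)
  show "symp (ext_rel :: 'v free_alg \<Rightarrow> _)"
    by (rule sympI) (metis ext_rel_def minus_diff_eq two_sided_ideal_uminus)
  show "transp (ext_rel :: 'v free_alg \<Rightarrow> _)"
  proof (rule transpI)
    fix p q r :: "'v free_alg" assume "ext_rel p q" "ext_rel q r"
    then show "ext_rel p r"
      unfolding ext_rel_def using two_sided_ideal.add[of "p - q" _ "q - r"] by simp
  qed
qed

text \<open>
  The type \<open>'v ext_alg\<close> is the exterior algebra of the real vector space \<open>'v\<close>; the
  multiplication \<open>*\<close> is the exterior product.
\<close>

quotient_type (overloaded) 'v ext_alg = "'v::real_vector free_alg" / ext_rel
  by (rule equivp_ext_rel)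

text \<open>Linear extension to the free algebra of a function on words\<close>

definition lin_ext :: "('v list \<Rightarrow> real) \<Rightarrow> 'v free_alg \<Rightarrow> real"
  where "lin_ext F p = (\<Sum>m\<in>Poly_Mapping.keys p. Poly_Mapping.lookup p m * F (letters m))"

lemma lin_ext_superset:
  assumes "finite A" "Poly_Mapping.keys p \<subseteq> A"
  shows "lin_ext F p = (\<Sum>m\<in>A. Poly_Mapping.lookup p m * F (letters m))"
  unfolding lin_ext_def
  by (rule sum.mono_neutral_left) (use assms in \<open>auto simp: in_keys_iff\<close>)

lemma lin_ext_add: "lin_ext F (p + q) = lin_ext F p + lin_ext F q"
proof -
  let ?A = "Poly_Mapping.keys p \<union> Poly_Mapping.keys q"
  have "lin_ext F (p + q) = (\<Sum>m\<in>?A. Poly_Mapping.lookup (p + q) m * F (letters m))"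
    by (rule lin_ext_superset) (auto dest: subsetD[OF keys_add])
  also have "\<dots> = (\<Sum>m\<in>?A. Poly_Mapping.lookup p m * F (letters m)) +
      (\<Sum>m\<in>?A. Poly_Mapping.lookup q m * F (letters m))"
    by (simp add: lookup_add algebra_simps sum.distrib)
  also have "\<dots> = lin_ext F p + lin_ext F q"
    by (subst (1 2) lin_ext_superset[of ?A]) auto
  finally show ?thesis .
qed

lemma lin_ext_uminus: "lin_ext F (- p) = - lin_ext F p"
proof -
  have "Poly_Mapping.keys (- p) = Poly_Mapping.keys p"
    by (auto simp: in_keys_iff)
  then show ?thesis by (simp add: lin_ext_def sum_negf)
qed

lemma lin_ext_minus: "lin_ext F (p - q) = lin_ext F p - lin_ext F q"
  using lin_ext_add[of F p "- q"] by (simp add: lin_ext_uminus)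

lemma lin_ext_zero: "lin_ext F 0 = 0"
  by (simp add: lin_ext_def)

lemma lin_ext_single: "lin_ext F (Poly_Mapping.single m c) = c * F (letters m)"
  by (simp add: lin_ext_def)

lemma lin_ext_one: "lin_ext F 1 = F []"
  using lin_ext_single[of F 0 1] by (simp only: single_one) (simp add: zero_fmon_def)

lemma lin_ext_sum: "lin_ext F (sum f A) = (\<Sum>i\<in>A. lin_ext F (f i))"
  by (induction A rule: infinite_finite_induct) (simp_all add: lin_ext_zero lin_ext_add)

lemma free_alg_sum_singles:
  "p = (\<Sum>m\<in>Poly_Mapping.keys p. Poly_Mapping.single m (Poly_Mapping.lookup p m))"
proof (rule poly_mapping_eqI)
  fix k
  show "Poly_Mapping.lookup p k = Poly_Mapping.lookup
      (\<Sum>m\<in>Poly_Mapping.keys p. Poly_Mapping.single m (Poly_Mapping.lookup p m)) k"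
    by (cases "k \<in> Poly_Mapping.keys p")
      (auto simp: lookup_sum lookup_single when_def in_keys_iff sum.delta)
qed

lemma lin_ext_scale: "lin_ext F (Poly_Mapping.single 0 c * p) = c * lin_ext F p"
proof -
  have "Poly_Mapping.single 0 c * p =
      (\<Sum>m\<in>Poly_Mapping.keys p. Poly_Mapping.single m (c * Poly_Mapping.lookup p m))"
    by (subst (1) free_alg_sum_singles[of p]) (simp add: sum_distrib_left mult_single)
  then have "lin_ext F (Poly_Mapping.single 0 c * p) =
      (\<Sum>m\<in>Poly_Mapping.keys p. c * Poly_Mapping.lookup p m * F (letters m))"
    by (simp only: lin_ext_sum lin_ext_single)
  then show ?thesis
    by (simp add: lin_ext_def sum_distrib_left mult.assoc)
qed

locale alternating_words =
  fixes F :: "'v::real_vector list \<Rightarrow> real"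
  assumes word_add: "F (l @ (v + w) # r) = F (l @ v # r) + F (l @ w # r)"
    and word_scaleR: "F (l @ (c *\<^sub>R v) # r) = c * F (l @ v # r)"
    and word_alt: "F (l @ v # v # r) = 0"
begin

lemma lin_ext_ideal_aux:
  assumes "x \<in> two_sided_ideal ext_relators"
  shows "lin_ext F (Poly_Mapping.single l c * x * Poly_Mapping.single r d) = 0"
  using assms
proof (induction arbitrary: l c r d)
  case (gen g)
  then consider (a) v w where "g = fword [v + w] - fword [v] - fword [w]"
    | (s) b v where "g = fword [b *\<^sub>R v] - Poly_Mapping.single 0 b * fword [v]"
    | (z) v where "g = fword [v, v]"
    unfolding ext_relators_def by blast
  then show ?case
  proof cases
    case a
    show ?thesis
      unfolding a by (simp add: fword_def algebra_simps mult_single lin_ext_minus lin_ext_add lin_ext_single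
          plus_fmon_def word_add)
  next
    case s
    show ?thesis
      unfolding s by (simp add: fword_def algebra_simps mult_single lin_ext_minus lin_ext_add lin_ext_single
          plus_fmon_def zero_fmon_def word_scaleR)
  next
    case z
    then show ?thesis
      by (simp add: fword_def mult_single lin_ext_single plus_fmon_def word_alt)
  qed
next
  case zero
  show ?case by (simp add: lin_ext_zero)
next
  case (add x y)
  then show ?case by (simp add: algebra_simps lin_ext_add)
next
  case (mult_left x q)
  have "Poly_Mapping.single l c * (q * x) * Poly_Mapping.single r d =
    (\<Sum>m\<in>Poly_Mapping.keys q.
      Poly_Mapping.single (l + m) (c * Poly_Mapping.lookup q m) * x * Poly_Mapping.single r d)"
    by (subst (1) free_alg_sum_singles[of q])
      (simp add: sum_distrib_left sum_distrib_right mult.assoc[symmetric] mult_single)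
  then show ?case by (simp add: lin_ext_sum mult_left.IH)
next
  case (mult_right x q)
  have "Poly_Mapping.single l c * (x * q) * Poly_Mapping.single r d =
    (\<Sum>m\<in>Poly_Mapping.keys q.
      Poly_Mapping.single l c * x * Poly_Mapping.single (m + r) (Poly_Mapping.lookup q m * d))"
    by (subst (1) free_alg_sum_singles[of q])
      (simp add: sum_distrib_left sum_distrib_right mult.assoc mult_single)
  then show ?case by (simp add: lin_ext_sum mult_right.IH)
qed

lemma lin_ext_ideal: "x \<in> two_sided_ideal ext_relators \<Longrightarrow> lin_ext F x = 0"
  using lin_ext_ideal_aux[of x 0 1 0 1] by simp

lemma lin_ext_cong: "ext_rel p q \<Longrightarrow> lin_ext F p = lin_ext F q"
  using lin_ext_ideal[of "p - q"] by (simp add: ext_rel_def lin_ext_minus)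

end

instantiation ext_alg :: (real_vector) real_algebra_1
begin

lift_definition zero_ext_alg :: "'a ext_alg" is 0 .
lift_definition one_ext_alg :: "'a ext_alg" is 1 .
lift_definition plus_ext_alg :: "'a ext_alg \<Rightarrow> 'a ext_alg \<Rightarrow> 'a ext_alg" is "(+)"
  by (rule ext_rel_add)
lift_definition minus_ext_alg :: "'a ext_alg \<Rightarrow> 'a ext_alg \<Rightarrow> 'a ext_alg" is "(-)"
  by (rule ext_rel_minus)
lift_definition uminus_ext_alg :: "'a ext_alg \<Rightarrow> 'a ext_alg" is uminus
  by (rule ext_rel_uminus)
lift_definition times_ext_alg :: "'a ext_alg \<Rightarrow> 'a ext_alg \<Rightarrow> 'a ext_alg" is "(*)"
  by (rule ext_rel_mult)
lift_definition scaleR_ext_alg :: "real \<Rightarrow> 'a ext_alg \<Rightarrow> 'a ext_alg"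
  is "\<lambda>c p. Poly_Mapping.single 0 c * p"
  by (rule ext_rel_mult[OF ext_rel_refl])

lemma single_zero_commute:
  "p * Poly_Mapping.single 0 c = Poly_Mapping.single 0 c * (p :: 'b free_alg)"
  by (subst (1 2) free_alg_sum_singles[of p])
    (simp add: sum_distrib_left sum_distrib_right mult_single mult.commute)

instance
proof
  fix x y z :: "'a ext_alg" and a b :: real
  show "x + y + z = x + (y + z)" "x + y = y + x" "0 + x = x" "- x + x = 0" "x - y = x + - y"
    by (transfer; simp add: algebra_simps ext_rel_refl)+
  show "x * y * z = x * (y * z)" "(x + y) * z = x * z + y * z" "x * (y + z) = x * y + x * z"
    "1 * x = x" "x * 1 = x"
    by (transfer; simp add: algebra_simps ext_rel_refl)+
  show "a *\<^sub>R (x + y) = a *\<^sub>R x + a *\<^sub>R y" "(a + b) *\<^sub>R x = a *\<^sub>R x + b *\<^sub>R x"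
    by (transfer; simp add: algebra_simps single_add ext_rel_refl)+
  show "a *\<^sub>R b *\<^sub>R x = (a * b) *\<^sub>R x" "1 *\<^sub>R x = x"
    by (transfer; simp add: mult.assoc[symmetric] mult_single ext_rel_refl)+
  show "a *\<^sub>R x * y = a *\<^sub>R (x * y)"
    by transfer (simp add: mult.assoc ext_rel_refl)
  show "x * a *\<^sub>R y = a *\<^sub>R (x * y)"
    by transfer (simp only: mult.assoc[symmetric] single_zero_commute ext_rel_refl)
  have "alternating_words (\<lambda>xs :: 'a list. if xs = [] then 1 else 0)"
    by unfold_locales auto
  from alternating_words.lin_ext_cong[OF this, of 0 1]
  have "\<not> ext_rel (0 :: 'a free_alg) 1"
    by (auto simp: lin_ext_zero lin_ext_one)
  then show "(0 :: 'a ext_alg) \<noteq> 1"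
    by transfer
qed

end

lift_definition ext_vec :: "'v::real_vector \<Rightarrow> 'v ext_alg" is "\<lambda>v. fword [v]" .

definition wedge_list :: "'v::real_vector list \<Rightarrow> 'v ext_alg"
  where "wedge_list vs = prod_list (map ext_vec vs)"

definition ext_power :: "nat \<Rightarrow> 'v::real_vector ext_alg set"
  where "ext_power k = span {wedge_list vs | vs. length vs = k}"

text \<open>In degree 0 a separate clause is needed: the empty exterior product is only \<open>1\<close>.\<close>

definition decomposable :: "nat \<Rightarrow> 'v::real_vector ext_alg set" where
  "decomposable r = (if r = 0 then range of_real else {wedge_list vs | vs. length vs = r})"

lemma wedge_list_Nil [simp]: "wedge_list [] = 1"
  by (simp add: wedge_list_def)

lemma wedge_list_Cons [simp]: "wedge_list (v # vs) = ext_vec v * wedge_list vs"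
  by (simp add: wedge_list_def)

lemma ext_vec_add: "ext_vec (v + w) = ext_vec v + ext_vec w"
proof transfer
  fix v w :: 'a
  have "fword [v + w] - fword [v] - fword [w] \<in> two_sided_ideal ext_relators"
    by (rule two_sided_ideal.gen) (auto simp: ext_relators_def)
  then show "ext_rel (fword [v + w]) (fword [v] + fword [w])"
    by (simp add: ext_rel_def algebra_simps)
qed

lemma ext_vec_scaleR: "ext_vec (c *\<^sub>R v) = c *\<^sub>R ext_vec v"
proof transfer
  fix c and v :: 'a
  have "fword [c *\<^sub>R v] - Poly_Mapping.single 0 c * fword [v] \<in> two_sided_ideal ext_relators"
    by (rule two_sided_ideal.gen) (auto simp: ext_relators_def)
  then show "ext_rel (fword [c *\<^sub>R v]) (Poly_Mapping.single 0 c * fword [v])"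
    by (simp add: ext_rel_def)
qed

lemma linear_ext_vec: "linear ext_vec"
  by (simp add: linear_iff ext_vec_add ext_vec_scaleR)

lemma ext_vec_square: "ext_vec v * ext_vec v = 0"
proof transfer
  fix v :: 'a
  have "fword [v, v] \<in> two_sided_ideal ext_relators"
    by (rule two_sided_ideal.gen) (auto simp: ext_relators_def)
  then show "ext_rel (fword [v] * fword [v]) 0"
    by (simp add: ext_rel_def fword_def mult_single plus_fmon_def)
qed

lemma ext_vec_anticommute: "ext_vec v * ext_vec w = - (ext_vec w * ext_vec v)"
  using ext_vec_square[of "v + w"]
  by (simp add: ext_vec_add algebra_simps ext_vec_square add_eq_0_iff)

lemma fword_Cons: "fword (v # vs) = fword [v] * fword vs"
  by (simp add: fword_def mult_single plus_fmon_def)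

lemma abs_fword: "abs_ext_alg (fword vs) = wedge_list vs"
proof (induction vs)
  case Nil
  then show ?case
    by (simp add: fword_def one_ext_alg_def flip: zero_fmon_def)
next
  case (Cons v vs)
  then show ?case
    by (subst fword_Cons) (simp add: times_ext_alg.abs_eq[symmetric] ext_vec.abs_eq)
qed

lemma abs_single: "abs_ext_alg (Poly_Mapping.single m c) = c *\<^sub>R wedge_list (letters m)"
proof -
  have "Poly_Mapping.single m c = Poly_Mapping.single 0 c * fword (letters m)"
    by (simp add: fword_def mult_single)
  then show ?thesis
    by (simp add: scaleR_ext_alg.abs_eq[symmetric] abs_fword)
qed

lemma span_wedge_list: "span (range wedge_list) = (UNIV :: 'v::real_vector ext_alg set)"
proof -
  have "abs_ext_alg p \<in> span (range wedge_list)" for p :: "'v free_alg"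
  proof -
    have "abs_ext_alg (\<Sum>m\<in>A. Poly_Mapping.single m (c m)) \<in> span (range wedge_list)"
      if "finite A" for A :: "'v fmon set" and c

      using that
    proof (induction A)
      case empty
      then show ?case
        by (simp add: span_zero flip: zero_ext_alg.abs_eq)
    next
      case (insert m A)
      have "c m *\<^sub>R wedge_list (letters m) \<in> span (range wedge_list)"
        by (intro span_scale span_base) simp
      with insert show ?case
        by (simp add: plus_ext_alg.abs_eq[symmetric] abs_single span_add)
    qed
    from this[OF finite_keys, of "Poly_Mapping.lookup p" p] show ?thesis
      by (simp flip: free_alg_sum_singles)
  qed
  then have "x \<in> span (range wedge_list)" for x :: "'v ext_alg"
    by (induction x rule: ext_alg.abs_induct)
  then show ?thesis by auto
qed


section \<open>The pairing between the exterior algebras of a space and its dual\<close>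

definition word_pairing :: "'v::real_vector list \<Rightarrow> 'v dual list \<Rightarrow> real" where
  "word_pairing vs ws =
     (if length vs = length ws
      then det (mat (length vs) (length vs) (\<lambda>(i, j). dual_apply (ws ! j) (vs ! i))) else 0)"

lemma det_row_linear:
  fixes f g h :: "nat \<Rightarrow> real"
  assumes "k < n" and "\<And>i j. i < n \<Longrightarrow> i \<noteq> k \<Longrightarrow> j < n \<Longrightarrow> A i j = C i j \<and> B i j = C i j"
    and "\<And>j. j < n \<Longrightarrow> C k j = c * A k j + d * B k j"
  shows "det (mat n n (\<lambda>(i, j). C i j)) =
    c * det (mat n n (\<lambda>(i, j). A i j)) + d * det (mat n n (\<lambda>(i, j). B i j :: real))"
proof -
  have "(\<Prod>i = 0..<n. C i (p i)) = c * (\<Prod>i = 0..<n. A i (p i)) + d * (\<Prod>i = 0..<n. B i (p i))"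
    if p: "p permutes {0..<n}" for p
  proof -
    have pn: "p i < n" if "i < n" for i
      using permutes_in_image[OF p, of i] that by simp
    have split: "(\<Prod>i = 0..<n. X i (p i)) = X k (p k) * (\<Prod>i\<in>{0..<n} - {k}. X i (p i))"
      for X :: "nat \<Rightarrow> nat \<Rightarrow> real"
      by (rule prod.remove) (use assms(1) in auto)
    have "(\<Prod>i\<in>{0..<n} - {k}. A i (p i)) = (\<Prod>i\<in>{0..<n} - {k}. C i (p i))"
      "(\<Prod>i\<in>{0..<n} - {k}. B i (p i)) = (\<Prod>i\<in>{0..<n} - {k}. C i (p i))"
      by (rule prod.cong; use assms(2) pn in auto)+
    then show ?thesis
      unfolding split[of A] split[of B] split[of C] using assms(3)[OF pn[OF assms(1)]]
      by (simp add: algebra_simps)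
  qed
  moreover have "det (mat n n (\<lambda>(i, j). X i j)) =
      (\<Sum>p | p permutes {0..<n}. signof p * (\<Prod>i = 0..<n. X i (p i)))" for X :: "nat \<Rightarrow> nat \<Rightarrow> real"
  proof -
    have "(\<Prod>i = 0..<n. mat n n (\<lambda>(i, j). X i j) $$ (i, p i)) = (\<Prod>i = 0..<n. X i (p i))"
      if p: "p permutes {0..<n}" for p
      by (rule prod.cong) (use permutes_in_image[OF p] in auto)
    then show ?thesis
      unfolding det_def by (auto intro!: sum.cong)
  qed
  ultimately show ?thesis
    by (simp add: sum_distrib_left sum.distrib[symmetric] algebra_simps)
qed

lemma alternating_words_det:
  fixes h :: "'v::real_vector \<Rightarrow> nat \<Rightarrow> real"
  assumes "\<And>j. linear (\<lambda>v. h v j)"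
  shows "alternating_words (\<lambda>vs. if length vs = n
    then det (mat n n (\<lambda>(i, j). h (vs ! i) j)) else 0)"
proof
  note lin = linear_add[OF assms] linear_scale[OF assms]
  fix l r :: "'v list" and v w :: 'v and c :: real
  let ?D = "\<lambda>vs. det (mat n n (\<lambda>(i, j). h (vs ! i) j))"
  have nth_eq: "(l @ x # r) ! i = (l @ y # r) ! i" if "i \<noteq> length l" for x y i
    using that by (auto simp: nth_append nth_Cons')
  show "(if length (l @ (v + w) # r) = n then ?D (l @ (v + w) # r) else 0) =
    (if length (l @ v # r) = n then ?D (l @ v # r) else 0) +
    (if length (l @ w # r) = n then ?D (l @ w # r) else 0)"
    using det_row_linear[of "length l" n "\<lambda>i. h ((l @ v # r) ! i)" "\<lambda>i. h ((l @ (v + w) # r) ! i)"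
        "\<lambda>i. h ((l @ w # r) ! i)" 1 1] nth_eq[of _ v "v + w"] nth_eq[of _ w "v + w"]
    by (auto simp: lin)
  show "(if length (l @ (c *\<^sub>R v) # r) = n then ?D (l @ (c *\<^sub>R v) # r) else 0) =
    c * (if length (l @ v # r) = n then ?D (l @ v # r) else 0)"
    using det_row_linear[of "length l" n "\<lambda>i. h ((l @ v # r) ! i)" "\<lambda>i. h ((l @ (c *\<^sub>R v) # r) ! i)"
        "\<lambda>i. h ((l @ v # r) ! i)" c 0] nth_eq[of _ v "c *\<^sub>R v"]
    by (auto simp: lin)
  show "(if length (l @ v # v # r) = n then ?D (l @ v # v # r) else 0) = 0"
  proof (cases "length (l @ v # v # r) = n")
    case True
    have "?D (l @ v # v # r) = 0"
      by (rule det_identical_rows[of _ n "length l" "Suc (length l)"])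
        (use True in \<open>auto simp: nth_append intro!: eq_vecI\<close>)
    then show ?thesis by simp
  qed simp
qed

lemma word_pairing_transpose:
  "word_pairing vs ws = (if length ws = length vs
    then det (mat (length vs) (length vs) (\<lambda>(i, j). dual_apply (ws ! i) (vs ! j))) else 0)"
proof -
  let ?M = "mat (length vs) (length vs) (\<lambda>(i, j). dual_apply (ws ! j) (vs ! i))"
  have "mat (length vs) (length vs) (\<lambda>(i, j). dual_apply (ws ! i) (vs ! j)) = transpose_mat ?M"
    by (rule eq_matI) auto
  moreover have "det (transpose_mat ?M) = det ?M"
    by (rule det_transpose) auto
  ultimately show ?thesis
    by (simp add: word_pairing_def)
qed

lemma alternating_word_pairing_left: "alternating_words (\<lambda>vs. word_pairing vs ws)"
proof -
  have eq: "(\<lambda>vs. word_pairing vs ws) = (\<lambda>vs. if length vs = length ws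
      then det (mat (length ws) (length ws) (\<lambda>(i, j). dual_apply (ws ! j) (vs ! i))) else 0)"
    by (auto simp: word_pairing_def)
  show ?thesis
    unfolding eq
    by (rule alternating_words_det[of "\<lambda>v j. dual_apply (ws ! j) v"]) (rule linear_dual_apply)
qed

lemma alternating_word_pairing_right: "alternating_words (word_pairing vs)"
proof -
  have eq: "word_pairing vs = (\<lambda>ws. if length ws = length vs
      then det (mat (length vs) (length vs) (\<lambda>(i, j). dual_apply (ws ! i) (vs ! j))) else 0)"
    by (rule ext) (rule word_pairing_transpose)
  show ?thesis
    unfolding eq
    by (rule alternating_words_det[of "\<lambda>w j. dual_apply w (vs ! j)"])
      (simp add: linear_iff dual_apply_add_left dual_apply_scaleR_left)
qed

lemma alternating_words_lin_ext:
  assumes "\<And>xs. alternating_words (\<lambda>vs. F vs xs)"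
  shows "alternating_words (\<lambda>vs. lin_ext (F vs) q)"
  by unfold_locales
    (simp_all add: lin_ext_def alternating_words.word_add[OF assms]
      alternating_words.word_scaleR[OF assms] alternating_words.word_alt[OF assms]
      algebra_simps sum.distrib sum_distrib_left)

lift_definition ext_pairing :: "'v::real_vector ext_alg \<Rightarrow> 'v dual ext_alg \<Rightarrow> real"
  is "\<lambda>p q. lin_ext (\<lambda>vs. lin_ext (word_pairing vs) q) p"
proof -
  fix p p' :: "'v free_alg" and q q' :: "'v dual free_alg"
  assume "ext_rel p p'" "ext_rel q q'"
  moreover have "alternating_words (\<lambda>vs. lin_ext (word_pairing vs) q)"
    by (rule alternating_words_lin_ext) (rule alternating_word_pairing_left)
  ultimately show "lin_ext (\<lambda>vs. lin_ext (word_pairing vs) q) p =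
      lin_ext (\<lambda>vs. lin_ext (word_pairing vs) q') p'"
    by (simp add: alternating_words.lin_ext_cong[of _ p p']
        alternating_words.lin_ext_cong[OF alternating_word_pairing_right, of q q'])
qed

lemma linear_ext_pairing_left: "linear (\<lambda>x. ext_pairing x y)"
  unfolding linear_iff by (safe; transfer) (simp_all add: lin_ext_add lin_ext_scale)

lemma linear_ext_pairing_right: "linear (ext_pairing x)"
  unfolding linear_iff
  by (safe; transfer)
    (simp_all add: lin_ext_add lin_ext_scale, simp_all add: lin_ext_def algebra_simps sum.distrib sum_distrib_left)

lemma ext_pairing_wedge_list:
  "ext_pairing (wedge_list vs) (wedge_list ws) =
     (if length vs = length ws
      then det (mat (length vs) (length vs) (\<lambda>(i, j). dual_apply (ws ! j) (vs ! i))) else 0)"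
  by (simp add: ext_pairing.abs_eq fword_def lin_ext_single word_pairing_def flip: abs_fword)


section \<open>Interior product and self-annihilating subspaces\<close>

text \<open>
  For a finite-dimensional space the element described here exists and is unique, see
  \<open>interior_prod_eq_iff\<close> below.
\<close>

definition interior_prod :: "'v::real_vector ext_alg \<Rightarrow> 'v dual ext_alg \<Rightarrow> 'v ext_alg"
  (infixl "\<llcorner>" 75) where
  "v \<llcorner> w = (THE x. \<forall>u. ext_pairing x u = ext_pairing v (w * u))"

definition self_annihilating :: "nat \<Rightarrow> 'v::real_vector ext_alg set \<Rightarrow> bool" where
  "self_annihilating t W \<longleftrightarrow>
     (\<forall>r<t. \<forall>y\<in>decomposable r. \<forall>u\<in>W. \<forall>w\<in>W. (u \<llcorner> y) * (w \<llcorner> y) = 0)"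

lemma ext_vec_mult_sorted:
  assumes "sorted xs"
  shows "\<exists>s. ext_vec (f i) * wedge_list (map f xs) = s *\<^sub>R wedge_list (map f (insort i xs))"
  using assms
proof (induction xs)
  case Nil
  show ?case by (rule exI[of _ 1]) simp
next
  case (Cons x xs)
  show ?case
  proof (cases "i \<le> x")
    case True
    then show ?thesis by (intro exI[of _ 1]) simp
  next
    case False
    from Cons obtain s
      where s: "ext_vec (f i) * wedge_list (map f xs) = s *\<^sub>R wedge_list (map f (insort i xs))"
      by auto
    have "ext_vec (f i) * wedge_list (map f (x # xs)) =
        - (ext_vec (f x) * (ext_vec (f i) * wedge_list (map f xs)))"
      by (simp add: mult.assoc[symmetric] ext_vec_anticommute[of "f i"])
    also have "\<dots> = (- s) *\<^sub>R wedge_list (map f (insort i (x # xs)))"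
      using False by (simp add: s)
    finally show ?thesis by blast
  qed
qed

lemma wedge_list_sorted_not_distinct:
  assumes "sorted xs" "\<not> distinct xs"
  shows "wedge_list (map f xs) = 0"
  using assms
proof (induction xs)
  case (Cons x xs)
  show ?case
  proof (cases "distinct xs")
    case True
    with Cons.prems have "x \<in> set xs" by simp
    with Cons.prems(1) obtain ys where "xs = x # ys"
      by (cases xs) fastforce+
    then show ?thesis by (simp add: mult.assoc[symmetric] ext_vec_square)
  qed (use Cons in simp)
qed simp

definition wedge_set :: "(nat \<Rightarrow> 'v::real_vector) \<Rightarrow> nat set \<Rightarrow> 'v ext_alg"
  where "wedge_set f S = wedge_list (map f (sorted_list_of_set S))"

lemma span_wedge_set:
  fixes f :: "nat \<Rightarrow> 'v::real_vector"
  assumes "span (f ` {..<n}) = UNIV"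
  shows "span (wedge_set f ` Pow {..<n}) = UNIV"
proof -
  let ?M = "span (wedge_set f ` Pow {..<n})"
  have basis_mult: "ext_vec (f i) * wedge_set f S \<in> ?M" if i: "i < n" and S: "S \<subseteq> {..<n}" for i S
  proof -
    let ?xs = "sorted_list_of_set S"
    have fin: "finite S" using S finite_subset by blast
    obtain s where s: "ext_vec (f i) * wedge_set f S = s *\<^sub>R wedge_list (map f (insort i ?xs))"
      using ext_vec_mult_sorted[of ?xs f i] by (auto simp: wedge_set_def)
    show ?thesis
    proof (cases "i \<in> S")
      case True
      then have "wedge_list (map f (insort i ?xs)) = 0"
        by (intro wedge_list_sorted_not_distinct) (auto simp: sorted_insort distinct_insort fin)
      then show ?thesis by (simp add: s span_zero)
    next
      case False
      then have "insort i ?xs = sorted_list_of_set (insert i S)"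
        using fin by (simp add: sorted_list_of_set.sorted_key_list_of_set_insert)
      then have "wedge_list (map f (insort i ?xs)) = wedge_set f (insert i S)"
        by (simp add: wedge_set_def)
      moreover have "wedge_set f (insert i S) \<in> ?M"
        using i S by (intro span_base) simp
      ultimately show ?thesis
        by (simp add: s span_scale)
    qed
  qed
  have vec_mult: "ext_vec v * x \<in> ?M" if "x \<in> ?M" for v x
    using that
  proof (induction rule: span_induct_alt)
    case base
    then show ?case by (simp add: span_zero)
  next
    case (step c e y)
    then obtain S where S: "S \<subseteq> {..<n}" "e = wedge_set f S" by auto
    have "v \<in> span (f ` {..<n})" using assms by simp
    then have "ext_vec v * e \<in> ?M"
    proof (induction rule: span_induct_alt)
      case base
      then show ?case by (simp add: linear_0[OF linear_ext_vec] span_zero)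
    next
      case (step b z v')
      then obtain i where "i < n" "z = f i" by auto
      then have "ext_vec z * e \<in> ?M" using basis_mult S by simp
      with step show ?case
        by (simp add: ext_vec_add ext_vec_scaleR distrib_right span_add span_scale)
    qed
    with step show ?case
      by (simp add: distrib_left span_add span_scale)
  qed
  have "wedge_list vs \<in> ?M" for vs
  proof (induction vs)
    case Nil
    have "1 = wedge_set f {}" by (simp add: wedge_set_def)
    then show ?case by (auto intro!: span_base)
  qed (simp add: vec_mult)
  then have "span (range wedge_list) \<subseteq> ?M"
    by (intro span_minimal) auto
  then show ?thesis by (simp add: span_wedge_list top.extremum_unique)
qed

lemma ext_pairing_wedge_set:
  assumes dual: "\<And>i j. i < n \<Longrightarrow> j < n \<Longrightarrow> dual_apply (d j) (b i) = (if i = j then 1 else 0)"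
    and S: "S \<subseteq> {..<n}" and T: "T \<subseteq> {..<n}"
  shows "ext_pairing (wedge_set b S) (wedge_set d T) = (if S = T then 1 else 0)"
proof -
  let ?s = "sorted_list_of_set S" and ?t = "sorted_list_of_set T"
  have fin: "finite S" "finite T" using S T finite_subset by blast+
  have sn: "?s ! i < n" if "i < card S" for i
    using nth_mem[of i ?s] that S fin by auto
  have tn: "?t ! i < n" if "i < card T" for i
    using nth_mem[of i ?t] that T fin by auto
  consider "S = T" | "S \<noteq> T" "card S \<noteq> card T" | "S \<noteq> T" "card S = card T" by blast
  then show ?thesis
  proof cases
    case 1
    have "mat (card S) (card S) (\<lambda>(i, j). dual_apply (map d ?s ! j) (map b ?s ! i)) = 1\<^sub>m (card S)"
      by (rule eq_matI) (auto simp: dual sn nth_eq_iff_index_eq)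
    with 1 show ?thesis
      by (simp add: wedge_set_def ext_pairing_wedge_list)
  next
    case 2
    then show ?thesis by (simp add: wedge_set_def ext_pairing_wedge_list)
  next
    case 3
    have "\<not> S \<subseteq> T"
      using 3 fin card_subset_eq by blast
    then obtain a where a: "a \<in> S" "a \<notin> T" by blast
    then obtain k where k: "k < card S" "?s ! k = a"
      using fin by (metis in_set_conv_nth length_sorted_list_of_set set_sorted_list_of_set)
    have "dual_apply (d (?t ! j)) (b (?s ! k)) = 0" if "j < card S" for j
    proof -
      have "?t ! j \<noteq> ?s ! k" using nth_mem[of j ?t] that 3(2) a k fin by auto
      moreover have "?t ! j < n" "?s ! k < n" using that 3(2) k sn tn by auto
      ultimately show ?thesis by (simp add: dual)
    qed
    then have "det (mat (card S) (card S) (\<lambda>(i, j). dual_apply (map d ?t ! j) (map b ?s ! i))) = 0"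
      using k 3
        det_row_linear[of k "card S" "\<lambda>i j. dual_apply (map d ?t ! j) (map b ?s ! i)"
          "\<lambda>i j. dual_apply (map d ?t ! j) (map b ?s ! i)"
          "\<lambda>i j. dual_apply (map d ?t ! j) (map b ?s ! i)" 0 0]
      by simp
    with 3 show ?thesis
      by (simp add: wedge_set_def ext_pairing_wedge_list)
  qed
qed

lemma dual_basis_exists:
  fixes B :: "'v::real_vector set"
  assumes "finite B" "independent B" "span B = UNIV"
  obtains n and b :: "nat \<Rightarrow> 'v" and d :: "nat \<Rightarrow> 'v dual" where
    "span (b ` {..<n}) = UNIV" "span (d ` {..<n}) = UNIV"
    "\<And>i j. i < n \<Longrightarrow> j < n \<Longrightarrow> dual_apply (d j) (b i) = (if i = j then 1 else 0)"
proof -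
  obtain n and b where b: "B = b ` {..<n :: nat}" "inj_on b {..<n}"
    using finite_imp_nat_seg_image_inj_on[OF assms(1)] by (auto simp: lessThan_def)
  define d where "d j = Abs_dual (\<lambda>v. representation B v (b j))" for j
  have "linear (\<lambda>v. representation B v x)" for x
    using assms by (auto simp: linear_iff real_vector.representation_add
        real_vector.representation_scale)
  then have d_apply: "dual_apply (d j) v = representation B v (b j)" for j v
    by (simp add: d_def Abs_dual_inverse)
  have f_eq: "f = (\<Sum>j<n. dual_apply f (b j) *\<^sub>R d j)" for f
  proof -
    have sum_apply: "dual_apply (\<Sum>j\<in>J. c j *\<^sub>R d j) v = (\<Sum>j\<in>J. c j * dual_apply (d j) v)"
      if "finite J" for J :: "nat set" and c v
      using that by (induction J)
        (simp_all add: dual_apply_add_left dual_apply_scaleR_left zero_dual.rep_eq)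
    have "dual_apply f v = dual_apply (\<Sum>j<n. dual_apply f (b j) *\<^sub>R d j) v" for v
    proof -
      have "v = (\<Sum>x\<in>B. representation B v x *\<^sub>R x)"
        using assms by (simp add: real_vector.sum_representation_eq)
      also have "\<dots> = (\<Sum>j<n. representation B v (b j) *\<^sub>R b j)"
        unfolding b(1) by (subst sum.reindex[OF b(2)]) (simp add: o_def)
      finally have v: "v = (\<Sum>j<n. representation B v (b j) *\<^sub>R b j)" .
      show ?thesis
        by (subst (1) v) (simp add: linear_sum[OF linear_dual_apply]
            linear_scale[OF linear_dual_apply] sum_apply d_apply mult.commute)
    qed
    then have "dual_apply f = dual_apply (\<Sum>j<n. dual_apply f (b j) *\<^sub>R d j)"
      by (rule ext)
    then show ?thesis by (simp only: dual_apply_inject)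
  qed
  have "f \<in> span (d ` {..<n})" for f
  proof -
    have "(\<Sum>j<n. dual_apply f (b j) *\<^sub>R d j) \<in> span (d ` {..<n})"
      by (rule span_sum, rule span_scale, rule span_base) simp
    then show ?thesis
      by (rule back_subst[OF _ f_eq[symmetric]])
  qed
  moreover have "dual_apply (d j) (b i) = (if i = j then 1 else 0)" if "i < n" "j < n" for i j
  proof -
    have "b i \<in> B" and "b i = b j \<longleftrightarrow> i = j"
      using that b inj_on_eq_iff[OF b(2), of i j] by auto
    then show ?thesis
      using real_vector.representation_basis[OF assms(2), of "b i"] by (auto simp: d_apply)
  qed
  ultimately show ?thesis
    using that[of b n d] assms(3) b(1) by blast
qed

lemma interior_prod_ex1:
  fixes B :: "'v::real_vector set" and v :: "'v ext_alg"
  assumes "finite B" "independent B" "span B = UNIV"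
  shows "\<exists>!x. \<forall>u. ext_pairing x u = ext_pairing v (w * u)"
proof -
  obtain n and b :: "nat \<Rightarrow> 'v" and d where
    b: "span (b ` {..<n}) = UNIV" and d: "span (d ` {..<n}) = UNIV"
    and dual: "\<And>i j. i < n \<Longrightarrow> j < n \<Longrightarrow> dual_apply (d j) (b i) = (if i = j then 1 else 0)"
    using dual_basis_exists[OF assms] by metis
  note pair = ext_pairing_wedge_set[OF dual]
  define F where "F u = ext_pairing v (w * u)" for u
  have F: "linear F"
    by (simp add: F_def linear_iff distrib_left linear_add[OF linear_ext_pairing_right]
        linear_scale[OF linear_ext_pairing_right])
  have pair_sum: "ext_pairing (\<Sum>S\<in>Pow {..<n}. c S *\<^sub>R wedge_set b S) (wedge_set d T) = c T"
    if "T \<subseteq> {..<n}" for c T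
  proof -
    have "ext_pairing (\<Sum>S\<in>Pow {..<n}. c S *\<^sub>R wedge_set b S) (wedge_set d T) =
        (\<Sum>S\<in>Pow {..<n}. c S * ext_pairing (wedge_set b S) (wedge_set d T))"
      by (simp add: linear_sum[OF linear_ext_pairing_left] linear_scale[OF linear_ext_pairing_left])
    also have "\<dots> = (\<Sum>S\<in>Pow {..<n}. if S = T then c S else 0)"
      by (rule sum.cong) (use that in \<open>auto simp: pair\<close>)
    also have "\<dots> = c T" using that by simp
    finally show ?thesis .
  qed
  define x where "x = (\<Sum>S\<in>Pow {..<n}. F (wedge_set d S) *\<^sub>R wedge_set b S)"
  have "ext_pairing x u = F u" for u
  proof (rule linear_eq_on_span[OF linear_ext_pairing_right F, of "wedge_set d ` Pow {..<n}"])
    show "u \<in> span (wedge_set d ` Pow {..<n})" by (simp add: span_wedge_set[OF d])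
  qed (auto simp: x_def pair_sum)
  moreover have "y = x" if "\<And>u. ext_pairing y u = F u" for y
  proof -
    have y: "y = (\<Sum>S\<in>Pow {..<n}. ext_pairing y (wedge_set d S) *\<^sub>R wedge_set b S)" for y
    proof -
      have lin: "linear (\<lambda>y. \<Sum>S\<in>Pow {..<n}. ext_pairing y (wedge_set d S) *\<^sub>R wedge_set b S)"
        by (simp add: linear_iff linear_add[OF linear_ext_pairing_left]
            linear_scale[OF linear_ext_pairing_left] scaleR_add_left sum.distrib scaleR_right.sum)
      show ?thesis
      proof (rule linear_eq_on_span[OF linear_id[unfolded id_def] lin,
            of "wedge_set b ` Pow {..<n}"])
        show "y \<in> span (wedge_set b ` Pow {..<n})" by (simp add: span_wedge_set[OF b])
        fix z assume "z \<in> wedge_set b ` Pow {..<n}"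
        then obtain T where T: "T \<subseteq> {..<n}" "z = wedge_set b T" by auto
        have "(\<Sum>S\<in>Pow {..<n}. ext_pairing z (wedge_set d S) *\<^sub>R wedge_set b S) =
            (\<Sum>S\<in>Pow {..<n}. if S = T then wedge_set b S else 0)"
          by (rule sum.cong) (use T in \<open>auto simp: pair\<close>)
        then show "z = (\<Sum>S\<in>Pow {..<n}. ext_pairing z (wedge_set d S) *\<^sub>R wedge_set b S)"
          using T by simp
      qed
    qed
    show ?thesis
      by (subst y) (simp add: that x_def)
  qed
  ultimately show ?thesis
    unfolding F_def[symmetric] by (intro ex1I[of _ x]) auto
qed

lemma interior_prod_eq_iff:
  fixes B :: "'v::real_vector set" and v x :: "'v ext_alg"
  assumes "finite B" "independent B" "span B = UNIV"
  shows "v \<llcorner> w = x \<longleftrightarrow> (\<forall>u. ext_pairing x u = ext_pairing v (w * u))"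
proof
  assume "v \<llcorner> w = x"
  then show "\<forall>u. ext_pairing x u = ext_pairing v (w * u)"
    using theI'[OF interior_prod_ex1[OF assms, of v w]] by (simp add: interior_prod_def)
next
  assume "\<forall>u. ext_pairing x u = ext_pairing v (w * u)"
  then show "v \<llcorner> w = x"
    unfolding interior_prod_def by (rule the1_equality[OF interior_prod_ex1[OF assms]])
qed


section \<open>Intersecting families\<close>

definition t_intersecting :: "nat \<Rightarrow> 'a set set \<Rightarrow> bool" where
  "t_intersecting t \<A> \<longleftrightarrow> (\<forall>A\<in>\<A>. \<forall>B\<in>\<A>. t \<le> card (A \<inter> B))"

definition uniform :: "nat \<Rightarrow> 'a set set \<Rightarrow> bool" where
  "uniform a \<A> \<longleftrightarrow> (\<forall>A\<in>\<A>. card A = a)"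

definition AK :: "nat \<Rightarrow> nat \<Rightarrow> nat \<Rightarrow> nat" where
  "AK n a t = Max {card \<A> | \<A>. \<A> \<subseteq> Pow {1..n} \<and> uniform a \<A> \<and> t_intersecting t \<A>}"

end

theory Submission
  imports Defs "HOL-Library.Nat_Bijection"
begin

text \<open>
  The proof degenerates \<open>W\<close> to a family of sets by passing to leading monomials. Fix a basis of
  the space, with its dual basis. An element of the exterior algebra is then a linear combination
  of monomials, one for each set \<open>S\<close> of indices below \<open>n\<close>. The monomials are ordered by the
  weight \<open>set_encode S\<close>, the sum of \<open>2 ^ i\<close> over \<open>i \<in> S\<close>. This weight determines \<open>S\<close> and is
  additive on disjoint unions, which makes leading monomials multiplicative: if \<open>x\<close> and \<open>y\<close> have
  disjoint leading sets \<open>A\<close> and \<open>B\<close>, the only way to reach the monomial of \<open>A \<union> B\<close> in \<open>x * y\<close>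
  is from the two leading terms, so that \<open>x * y \<noteq> 0\<close> (\<open>leading_imp_mult_nonzero\<close>). For the same
  reason contraction with the dual monomial of a set \<open>C \<subseteq> A\<close> replaces the leading set \<open>A\<close> by
  \<open>A - C\<close> (\<open>leading_interior_prod\<close>).

  Let \<open>u, w \<in> W\<close> have leading sets \<open>A\<close> and \<open>B\<close>, and put \<open>C = A \<inter> B\<close>. Contraction with the
  monomial of \<open>C\<close> leaves elements whose leading sets \<open>A - C\<close> and \<open>B - C\<close> are disjoint, so their
  product does not vanish; as \<open>W\<close> is \<open>t\<close>-self-annihilating, this forces \<open>card C \<ge> t\<close>. Hence the
  leading sets of the elements of \<open>W\<close> form a \<open>t\<close>-intersecting family (\<open>t_intersecting_leading\<close>),
  which is \<open>a\<close>-uniform because \<open>W\<close> is homogeneous of degree \<open>a\<close>. Gaussian elimination shows that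
  elements of \<open>W\<close> realising the different leading sets span \<open>W\<close> (\<open>dim_le_card_leading\<close>), so this
  family has at least \<open>dim W\<close> members.
\<close>

section \<open>Products of monomials\<close>

text \<open>
  This sharpens \<open>ext_vec_mult_sorted\<close> by recording that the scalar is a sign: leading terms must
  not be lost when monomials are multiplied.
\<close>

lemma ext_vec_mult_sorted_sign:
  assumes "sorted xs"
  shows "\<exists>s\<in>{1, - 1}. ext_vec (f i) * wedge_list (map f xs) =
    s *\<^sub>R wedge_list (map f (insort i xs))"
  using assms
proof (induction xs)
  case Nil
  show ?case by (rule bexI[of _ 1]) simp_all
next
  case (Cons x xs)
  show ?case
  proof (cases "i \<le> x")
    case True
    then show ?thesis by (intro bexI[of _ 1]) simp_all
  next
    case False
    have "sorted xs" using Cons.prems by simp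
    then obtain s where s: "s \<in> {1, - 1}"
      "ext_vec (f i) * wedge_list (map f xs) = s *\<^sub>R wedge_list (map f (insort i xs))"
      using Cons.IH by blast
    have "ext_vec (f i) * wedge_list (map f (x # xs)) =
        - (ext_vec (f x) * (ext_vec (f i) * wedge_list (map f xs)))"
      by (simp add: mult.assoc[symmetric] ext_vec_anticommute[of "f i"])
    also have "\<dots> = (- s) *\<^sub>R wedge_list (map f (insort i (x # xs)))"
      using False by (simp add: s(2))
    finally show ?thesis using s(1) by (intro bexI[of _ "- s"]) auto
  qed
qed

lemma ext_vec_mult_wedge_set:
  assumes "finite T" "i \<notin> T"
  shows "\<exists>s\<in>{1, - 1}. ext_vec (f i) * wedge_set f T = s *\<^sub>R wedge_set f (insert i T)"
  using ext_vec_mult_sorted_sign[of "sorted_list_of_set T" f i] assms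
  by (simp add: wedge_set_def sorted_list_of_set.sorted_key_list_of_set_insert)

lemma ext_vec_mult_wedge_set_eq_0:
  assumes "finite T" "i \<in> T"
  shows "ext_vec (f i) * wedge_set f T = 0"
proof -
  obtain s where "ext_vec (f i) * wedge_set f T =
      s *\<^sub>R wedge_list (map f (insort i (sorted_list_of_set T)))"
    using ext_vec_mult_sorted[of "sorted_list_of_set T" f i] by (auto simp: wedge_set_def)
  moreover have "wedge_list (map f (insort i (sorted_list_of_set T))) = 0"
    by (intro wedge_list_sorted_not_distinct) (use assms in \<open>auto simp: sorted_insort distinct_insort\<close>)
  ultimately show ?thesis by simp
qed

text \<open>
  The induction removes the smallest index of the left factor, which is the first letter of its
  word.
\<close>

lemma wedge_set_mult:
  assumes "finite S" "finite T"
  shows "S \<inter> T = {} \<Longrightarrow>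
      \<exists>s\<in>{1, - 1}. wedge_set f S * wedge_set f T = s *\<^sub>R wedge_set f (S \<union> T)"
    and "S \<inter> T \<noteq> {} \<Longrightarrow> wedge_set f S * wedge_set f T = 0"
proof -
  have "(S \<inter> T = {} \<longrightarrow>
      (\<exists>s\<in>{1, - 1}. wedge_set f S * wedge_set f T = s *\<^sub>R wedge_set f (S \<union> T))) \<and>
    (S \<inter> T \<noteq> {} \<longrightarrow> wedge_set f S * wedge_set f T = 0)"
    using assms(1)
  proof (induction S rule: finite_linorder_min_induct)
    case empty
    show ?case by (auto simp: wedge_set_def)
  next
    case (insert i S)
    have "insort i (sorted_list_of_set S) = i # sorted_list_of_set S"
      using insert(1,2) by (intro insort_is_Cons) (auto intro: less_imp_le)
    then have "sorted_list_of_set (insert i S) = i # sorted_list_of_set S"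
      using insert(1,2) by (subst sorted_list_of_set.sorted_key_list_of_set_insert) auto
    then have split: "wedge_set f (insert i S) * wedge_set f T =
        ext_vec (f i) * (wedge_set f S * wedge_set f T)"
      by (simp add: wedge_set_def mult.assoc)
    show ?case
    proof (cases "S \<inter> T = {}")
      case False
      then show ?thesis using insert(3) by (auto simp: split)
    next
      case True
      then obtain s where s: "s \<in> {1, - 1}"
        "wedge_set f S * wedge_set f T = s *\<^sub>R wedge_set f (S \<union> T)"
        using insert(3) by blast
      show ?thesis
      proof (cases "i \<in> T")
        case True
        then show ?thesis
          using ext_vec_mult_wedge_set_eq_0[of "S \<union> T" i f] insert(1) assms(2)
          by (auto simp: split s(2))
      next
        case False
        then obtain s' where s': "s' \<in> {1, - 1}"
          "ext_vec (f i) * wedge_set f (S \<union> T) = s' *\<^sub>R wedge_set f (insert i (S \<union> T))"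
          using ext_vec_mult_wedge_set[of "S \<union> T" i f] insert(1,2) assms(2) by blast
        have "wedge_set f (insert i S) * wedge_set f T =
            (s * s') *\<^sub>R wedge_set f (insert i S \<union> T)"
          by (simp add: split s(2) s'(2))
        moreover have "s * s' \<in> {1, - 1}" using s(1) s'(1) by auto
        ultimately show ?thesis using True False by blast
      qed
    qed
  qed
  then show "S \<inter> T = {} \<Longrightarrow>
      \<exists>s\<in>{1, - 1}. wedge_set f S * wedge_set f T = s *\<^sub>R wedge_set f (S \<union> T)"
    and "S \<inter> T \<noteq> {} \<Longrightarrow> wedge_set f S * wedge_set f T = 0"
    by blast+
qed

lemma set_encode_Un_disjoint:
  assumes "finite S" "finite T" "S \<inter> T = {}"
  shows "set_encode (S \<union> T) = set_encode S + set_encode T"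
  using assms by (simp add: set_encode_def sum.union_disjoint)


section \<open>Coordinates and leading sets\<close>

locale dual_bases =
  fixes n :: nat and b :: "nat \<Rightarrow> 'v::real_vector" and d :: "nat \<Rightarrow> 'v dual"
  assumes span_b: "span (b ` {..<n}) = UNIV"
    and dual: "\<And>i j. i < n \<Longrightarrow> j < n \<Longrightarrow> dual_apply (d j) (b i) = (if i = j then 1 else 0)"
begin

lemma inj_on_b: "inj_on b {..<n}"
proof (rule inj_onI)
  fix i j assume ij: "i \<in> {..<n}" "j \<in> {..<n}" "b i = b j"
  have "dual_apply (d j) (b i) = 1"
    unfolding ij(3) using dual[of j j] ij(2) by simp
  moreover have "dual_apply (d j) (b i) = (if i = j then 1 else 0)"
    using dual[of i j] ij(1,2) by simp
  ultimately show "i = j" by (cases "i = j") simp_all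
qed

lemma independent_b: "independent (b ` {..<n})"
proof (rule independent_if_scalars_zero)
  fix c x assume sum: "(\<Sum>x\<in>b ` {..<n}. c x *\<^sub>R x) = 0" and "x \<in> b ` {..<n}"
  then obtain i where i: "i < n" "x = b i" by auto
  have "0 = dual_apply (d i) (\<Sum>j<n. c (b j) *\<^sub>R b j)"
    using sum by (simp add: sum.reindex[OF inj_on_b] linear_0[OF linear_dual_apply])
  also have "\<dots> = (\<Sum>j<n. c (b j) * dual_apply (d i) (b j))"
    by (simp add: linear_sum[OF linear_dual_apply] linear_scale[OF linear_dual_apply])
  also have "\<dots> = (\<Sum>j<n. if j = i then c (b j) else 0)"
    by (rule sum.cong) (use i in \<open>auto simp: dual\<close>)
  also have "\<dots> = c x" using i by simp
  finally show "c x = 0" by simp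
qed simp

lemma interior_prod_pairing:
  "ext_pairing (v \<llcorner> w) u = ext_pairing v (w * u)" for v :: "'v ext_alg"
  using iffD1[OF interior_prod_eq_iff[OF finite_imageI[OF finite_lessThan] independent_b span_b] refl]
  by (rule spec)

definition coord :: "'v ext_alg \<Rightarrow> nat set \<Rightarrow> real"
  where "coord x S = ext_pairing x (wedge_set d S)"

lemma linear_coord: "linear (\<lambda>x. coord x S)"
  unfolding coord_def by (rule linear_ext_pairing_left)

lemma coord_wedge_set:
  assumes "S \<subseteq> {..<n}" "T \<subseteq> {..<n}"
  shows "coord (wedge_set b S) T = (if S = T then 1 else 0)"
  unfolding coord_def by (rule ext_pairing_wedge_set[OF dual assms])

lemma eq_sum_coord: "x = (\<Sum>S\<in>Pow {..<n}. coord x S *\<^sub>R wedge_set b S)"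
proof -
  have lin: "linear (\<lambda>x. \<Sum>S\<in>Pow {..<n}. coord x S *\<^sub>R wedge_set b S)"
    by (simp add: linear_iff linear_add[OF linear_coord] linear_scale[OF linear_coord]
        scaleR_add_left sum.distrib scaleR_right.sum)
  show ?thesis
  proof (rule linear_eq_on_span[OF linear_id[unfolded id_def] lin,
        of "wedge_set b ` Pow {..<n}"])
    show "x \<in> span (wedge_set b ` Pow {..<n})" by (simp add: span_wedge_set[OF span_b])
    fix z assume "z \<in> wedge_set b ` Pow {..<n}"
    then obtain T where T: "T \<subseteq> {..<n}" "z = wedge_set b T" by auto
    have "(\<Sum>S\<in>Pow {..<n}. coord z S *\<^sub>R wedge_set b S) =
        (\<Sum>S\<in>Pow {..<n}. if S = T then wedge_set b S else 0)"
      by (rule sum.cong) (use T in \<open>auto simp: coord_wedge_set\<close>)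
    then show "z = (\<Sum>S\<in>Pow {..<n}. coord z S *\<^sub>R wedge_set b S)"
      using T by simp
  qed
qed

lemma coord_ext_power:
  assumes "x \<in> ext_power a" "card S \<noteq> a"
  shows "coord x S = 0"
  using assms(1) unfolding ext_power_def
proof (induction rule: span_induct_alt)
  case base
  show ?case by (rule linear_0[OF linear_coord])
next
  case (step c x y)
  then have "coord x S = 0"
    using assms(2) by (auto simp: coord_def wedge_set_def ext_pairing_wedge_list)
  with step show ?case
    by (simp add: linear_add[OF linear_coord] linear_scale[OF linear_coord])
qed

definition leading :: "'v ext_alg \<Rightarrow> nat set \<Rightarrow> bool"
  where "leading x A \<longleftrightarrow> A \<subseteq> {..<n} \<and> coord x A \<noteq> 0 \<and>
    (\<forall>S\<subseteq>{..<n}. coord x S \<noteq> 0 \<longrightarrow> set_encode S \<le> set_encode A)"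

lemma leading_exists:
  assumes "x \<noteq> 0"
  shows "\<exists>A. leading x A"
proof -
  let ?D = "{S \<in> Pow {..<n}. coord x S \<noteq> 0}"
  have nonempty: "?D \<noteq> {}"
  proof
    assume "?D = {}"
    then have "(\<Sum>S\<in>Pow {..<n}. coord x S *\<^sub>R wedge_set b S) = 0"
      by (intro sum.neutral) auto
    with eq_sum_coord[of x] have "x = 0" by (rule trans)
    with assms show False by contradiction
  qed
  have "finite ?D" by simp
  then obtain A where A: "A \<in> ?D" "Max (set_encode ` ?D) = set_encode A"
    using obtains_MAX[OF _ nonempty] by blast
  have "set_encode S \<le> set_encode A" if "S \<in> ?D" for S
    unfolding A(2)[symmetric] by (rule Max_ge) (use that in auto)
  with A(1) show ?thesis by (auto simp: leading_def)
qed

text \<open>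
  Every pair \<open>S, T\<close> that contributes to the coordinate of \<open>A \<union> B\<close> satisfies
  \<open>set_encode S \<le> set_encode A\<close> and \<open>set_encode T \<le> set_encode B\<close>, while the sums of the two sides
  agree. Hence both are equalities, and the weight determines the set.
\<close>

lemma leading_imp_mult_nonzero:
  assumes x: "leading x A" and y: "leading y B" and disj: "A \<inter> B = {}"
  shows "x * y \<noteq> 0"
proof -
  have A: "A \<subseteq> {..<n}" "finite A" and B: "B \<subseteq> {..<n}" "finite B"
    using x y finite_subset by (auto simp: leading_def)
  let ?c = "\<lambda>S T. coord (wedge_set b S * wedge_set b T) (A \<union> B)"
  have other: "coord x S * coord y T * ?c S T = 0"
    if ST: "S \<subseteq> {..<n}" "T \<subseteq> {..<n}" "(S, T) \<noteq> (A, B)" for S T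
  proof (rule ccontr)
    have fin: "finite S" "finite T" using ST finite_subset by auto
    assume nz: "coord x S * coord y T * ?c S T \<noteq> 0"
    have ST_disj: "S \<inter> T = {}"
    proof (rule ccontr)
      assume "S \<inter> T \<noteq> {}"
      then show False
        using nz wedge_set_mult(2)[OF fin, of b] by (simp add: linear_0[OF linear_coord])
    qed
    then obtain s where "wedge_set b S * wedge_set b T = s *\<^sub>R wedge_set b (S \<union> T)"
      using wedge_set_mult(1)[OF fin, of b] by blast
    with nz have union: "S \<union> T = A \<union> B"
      using ST A B by (auto simp: linear_scale[OF linear_coord] coord_wedge_set split: if_splits)
    have le: "set_encode S \<le> set_encode A" "set_encode T \<le> set_encode B"
      using x y nz ST by (auto simp: leading_def)
    moreover have "set_encode S + set_encode T = set_encode A + set_encode B"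
      using set_encode_Un_disjoint[OF fin ST_disj]
        set_encode_Un_disjoint[OF A(2) B(2) disj] union by simp
    ultimately have "set_encode S = set_encode A" "set_encode T = set_encode B" by linarith+
    then have "S = A" "T = B"
      using fin A B by (auto simp: set_encode_eq)
    with ST(3) show False by simp
  qed
  have "coord (x * y) (A \<union> B) =
      coord ((\<Sum>S\<in>Pow {..<n}. coord x S *\<^sub>R wedge_set b S) *
        (\<Sum>T\<in>Pow {..<n}. coord y T *\<^sub>R wedge_set b T)) (A \<union> B)"
    by (simp only: eq_sum_coord[symmetric])
  also have "\<dots> = (\<Sum>(S, T)\<in>Pow {..<n} \<times> Pow {..<n}. coord x S * coord y T * ?c S T)"
    by (simp add: sum_product linear_sum[OF linear_coord] linear_scale[OF linear_coord]
        sum.cartesian_product case_prod_beta mult_ac)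
  also have "\<dots> = (\<Sum>(S, T)\<in>{(A, B)}. coord x S * coord y T * ?c S T)"
  proof (rule sum.mono_neutral_right)
    show "\<forall>p\<in>Pow {..<n} \<times> Pow {..<n} - {(A, B)}.
        (case p of (S, T) \<Rightarrow> coord x S * coord y T * ?c S T) = 0"
    proof
      fix p assume p: "p \<in> Pow {..<n} \<times> Pow {..<n} - {(A, B)}"
      obtain S T where "p = (S, T)" by (cases p)
      with p other[of S T] show "(case p of (S, T) \<Rightarrow> coord x S * coord y T * ?c S T) = 0"
        by simp
    qed
  qed (use A B in auto)
  also have "\<dots> \<noteq> 0"
  proof -
    obtain s where "s \<in> {1, - 1}" "wedge_set b A * wedge_set b B = s *\<^sub>R wedge_set b (A \<union> B)"
      using wedge_set_mult(1)[OF A(2) B(2) disj, of b] by blast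
    then show ?thesis
      using A B x y by (auto simp: linear_scale[OF linear_coord] coord_wedge_set leading_def)
  qed
  finally show ?thesis by (auto simp: linear_0[OF linear_coord])
qed

text \<open>
  Contraction with the dual monomial of \<open>C\<close> moves the coordinate of \<open>C \<union> T\<close> to \<open>T\<close>, up to sign,
  and so lowers all the weights that survive by the same amount.
\<close>

lemma leading_interior_prod:
  assumes x: "leading x A" and C: "C \<subseteq> A"
  shows "leading (x \<llcorner> wedge_set d C) (A - C)"
proof -
  have A: "A \<subseteq> {..<n}" "finite A" "finite C"
    using x C finite_subset[of A "{..<n}"] finite_subset[of C A] by (auto simp: leading_def)
  have coord: "coord (x \<llcorner> wedge_set d C) T = ext_pairing x (wedge_set d C * wedge_set d T)" for T
    by (simp add: coord_def interior_prod_pairing)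
  have encode_A: "set_encode A = set_encode C + set_encode (A - C)"
    using set_encode_Un_disjoint[of C "A - C"] A C by (simp add: Un_absorb1)
  have "coord (x \<llcorner> wedge_set d C) (A - C) \<noteq> 0"
  proof -
    obtain s where "s \<in> {1, - 1}"
      "wedge_set d C * wedge_set d (A - C) = s *\<^sub>R wedge_set d (C \<union> (A - C))"
      using wedge_set_mult(1)[of C "A - C" d] A(2,3) by blast
    moreover have "C \<union> (A - C) = A" using C by auto
    ultimately have "coord (x \<llcorner> wedge_set d C) (A - C) = s * coord x A" "s \<noteq> 0"
      by (auto simp: coord coord_def[of x] linear_scale[OF linear_ext_pairing_right])
    then show ?thesis using x by (simp add: leading_def)
  qed
  moreover have "set_encode T \<le> set_encode (A - C)"
    if T: "T \<subseteq> {..<n}" "coord (x \<llcorner> wedge_set d C) T \<noteq> 0" for T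
  proof -
    have fin: "finite T" using T finite_subset by auto
    have disj: "C \<inter> T = {}"
    proof (rule ccontr)
      assume "C \<inter> T \<noteq> {}"
      then show False
        using T(2) wedge_set_mult(2)[OF A(3) fin, of d]
        by (simp add: coord linear_0[OF linear_ext_pairing_right])
    qed
    then obtain s where "wedge_set d C * wedge_set d T = s *\<^sub>R wedge_set d (C \<union> T)"
      using wedge_set_mult(1)[OF A(3) fin, of d] by blast
    with T(2) have "coord x (C \<union> T) \<noteq> 0"
      by (auto simp: coord coord_def[of x] linear_scale[OF linear_ext_pairing_right])
    then have "set_encode (C \<union> T) \<le> set_encode A"
      using x T(1) A(1) C by (auto simp: leading_def)
    then show ?thesis
      using set_encode_Un_disjoint[OF A(3) fin disj] encode_A by simp
  qed
  ultimately show ?thesis using A by (auto simp: leading_def)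
qed


section \<open>The leading sets of a subspace\<close>

definition leading_sets :: "'v ext_alg set \<Rightarrow> nat set set"
  where "leading_sets W = {A. \<exists>x\<in>W. leading x A}"

lemma leading_sets_subset: "leading_sets W \<subseteq> Pow {..<n}"
  by (auto simp: leading_sets_def leading_def)

lemma uniform_leading:
  assumes "W \<subseteq> ext_power a"
  shows "uniform a (leading_sets W)"
  using assms coord_ext_power by (fastforce simp: uniform_def leading_sets_def leading_def)

lemma t_intersecting_leading:
  assumes W: "self_annihilating t W"
  shows "t_intersecting t (leading_sets W)"
  unfolding t_intersecting_def
proof (intro ballI, rule ccontr)
  fix A B assume "A \<in> leading_sets W" "B \<in> leading_sets W" and less: "\<not> t \<le> card (A \<inter> B)"
  then obtain u w where u: "u \<in> W" "leading u A" and w: "w \<in> W" "leading w B"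
    by (auto simp: leading_sets_def)
  let ?C = "A \<inter> B"
  have "finite A" using u(2) finite_subset by (auto simp: leading_def)
  \<comment> \<open>For empty \<open>C\<close> the dual monomial is the scalar \<open>1\<close>, whence the instance of \<open>rangeI\<close>.\<close>
  then have "wedge_set d ?C \<in> decomposable (card ?C)"
    using rangeI[of of_real 1]
    by (auto simp: decomposable_def wedge_set_def intro!: exI[of _ "map d (sorted_list_of_set ?C)"])
  with W less u(1) w(1) have "(u \<llcorner> wedge_set d ?C) * (w \<llcorner> wedge_set d ?C) = 0"
    unfolding self_annihilating_def by (metis not_le)
  moreover have "(u \<llcorner> wedge_set d ?C) * (w \<llcorner> wedge_set d ?C) \<noteq> 0"
    by (rule leading_imp_mult_nonzero[OF leading_interior_prod[OF u(2)]
          leading_interior_prod[OF w(2)]]) auto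
  ultimately show False by contradiction
qed

text \<open>
  Gaussian elimination: subtracting a multiple of the chosen representative of its leading set from
  an element of \<open>W\<close> lowers the weight of the leading set.
\<close>

lemma dim_le_card_leading:
  assumes "subspace W"
  shows "dim W \<le> card (leading_sets W)"
proof -
  have fin: "finite (leading_sets W)"
    using finite_subset[OF leading_sets_subset] by simp
  have "\<forall>A\<in>leading_sets W. \<exists>x. x \<in> W \<and> leading x A"
    by (auto simp: leading_sets_def)
  then obtain g where g: "\<And>A. A \<in> leading_sets W \<Longrightarrow> g A \<in> W \<and> leading (g A) A"
    by (auto dest!: bchoice)
  have "x \<in> span (g ` leading_sets W)" if "leading x A" "x \<in> W" for x A
    using that
  proof (induction "set_encode A" arbitrary: x A rule: less_induct)
    case less
    then have A: "A \<in> leading_sets W" by (auto simp: leading_sets_def)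
    note gA = g[OF A]
    define c where "c = coord x A / coord (g A) A"
    define y where "y = x - c *\<^sub>R g A"
    have "y \<in> W"
      unfolding y_def using assms less.prems(2) gA by (simp add: subspace_diff subspace_scale)
    have coord_y: "coord y S = coord x S - c * coord (g A) S" for S
      by (simp add: y_def linear_diff[OF linear_coord] linear_scale[OF linear_coord])
    have "y \<in> span (g ` leading_sets W)"
    proof (cases "y = 0")
      case False
      then obtain A' where A': "leading y A'" using leading_exists by blast
      have "coord y A = 0"
        using gA by (simp add: coord_y c_def leading_def)
      with A' have "A' \<noteq> A" by (auto simp: leading_def)
      moreover have fin': "finite A" "finite A'"
        using A' gA finite_subset by (auto simp: leading_def)
      moreover have "set_encode A' \<le> set_encode A"
        using A' less.prems(1) gA by (auto simp: leading_def coord_y)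
      ultimately have "set_encode A' < set_encode A"
        by (auto simp: set_encode_eq order.strict_iff_order)
      then show ?thesis using A' \<open>y \<in> W\<close> by (rule less.hyps)
    qed (simp add: span_zero)
    moreover have "g A \<in> span (g ` leading_sets W)"
      using A by (simp add: span_base)
    moreover have "x = y + c *\<^sub>R g A" by (simp add: y_def)
    ultimately show ?case by (simp add: span_add span_scale)
  qed
  then have "x \<in> span (g ` leading_sets W)" if "x \<in> W" for x
    using that leading_exists[of x] by (cases "x = 0") (auto simp: span_zero)
  then have "W \<subseteq> span (g ` leading_sets W)" by blast
  then have "dim W \<le> card (g ` leading_sets W)"
    using fin by (intro dim_le_card) auto
  also have "\<dots> \<le> card (leading_sets W)"
    by (rule card_image_le[OF fin])
  finally show ?thesis .
qed

end


section \<open>The bound\<close>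

text \<open>
  The ground set \<open>{1..n}\<close> may be replaced by the initial segment that indexes a basis.
\<close>

lemma card_le_AK:
  assumes "\<A> \<subseteq> Pow {..<n}" "uniform a \<A>" "t_intersecting t \<A>"
  shows "card \<A> \<le> AK n a t"
proof -
  let ?B = "image Suc ` \<A>"
  have "inj_on (image Suc) \<A>"
    by (rule inj_on_image) simp
  then have card: "card ?B = card \<A>" by (rule card_image)
  have "?B \<subseteq> Pow {1..n}" using assms(1) by (fastforce simp: image_subset_iff Suc_le_eq)
  moreover have "uniform a ?B"
    using assms(2) by (auto simp: uniform_def card_image)
  moreover have "t_intersecting t ?B"
    using assms(3) by (auto simp: t_intersecting_def card_image simp flip: image_Int)
  moreover have "finite {card \<A> | \<A>. \<A> \<subseteq> Pow {1..n} \<and> uniform a \<A> \<and> t_intersecting t \<A>}"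
    by (rule finite_subset[of _ "card ` Pow (Pow {1..n})"]) auto
  ultimately have "card ?B \<le> AK n a t"
    unfolding AK_def by (intro Max_ge) blast+
  then show ?thesis by (simp add: card)
qed

theorem theorem2p12:
  fixes n a t :: nat and W :: "'v::real_vector ext_alg set"
  assumes "\<exists>B :: 'v set. finite B \<and> independent B \<and> span B = UNIV \<and> card B = n"
    and "t > 0"
    and "subspace W" and "W \<subseteq> ext_power a"
    and "self_annihilating t W"
  shows "dim W \<le> AK n a t"
proof -
  obtain B :: "'v set" where B: "finite B" "independent B" "span B = UNIV" "card B = n"
    using assms(1) by blast
  obtain m and b :: "nat \<Rightarrow> 'v" and d where "span (b ` {..<m}) = UNIV"
    "\<And>i j. i < m \<Longrightarrow> j < m \<Longrightarrow> dual_apply (d j) (b i) = (if i = j then 1 else 0)"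
    using dual_basis_exists[OF B(1-3)] by metis
  then interpret dual_bases m b d by unfold_locales
  have "card (b ` {..<m}) \<le> card B"
    using independent_span_bound[OF B(1) independent_b] B(3) by simp
  then have "m \<le> n"
    using B(4) by (simp add: card_image[OF inj_on_b])
  then have "leading_sets W \<subseteq> Pow {..<n}"
    using leading_sets_subset by fastforce
  then have "card (leading_sets W) \<le> AK n a t"
    using uniform_leading[OF assms(4)] t_intersecting_leading[OF assms(5)]
    by (rule card_le_AK)
  with dim_le_card_leading[OF assms(3)] show ?thesis by (rule order.trans)
qed

end
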